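(* Let $0<\delta<1$ be such that $d(\delta)>0$, where $d(\delta)=\inf\{2^n|\delta-k2^{-n}| : n\ge 0,\ k\in\mathbb{Z}\}$. Then for every $\varphi\in L^1(\mathbb{T})$, \[ \|\varphi\|_{\mathrm{BMO}(\mathbb{T})}\le \frac{4}{d(\delta)}\max\left\{\|\varphi\|_{\mathrm{BMO}_{\mathcal D}(\mathbb{T})},\ \|\varphi(\cdot-2\delta\pi)\|_{\mathrm{BMO}_{\mathcal D}(\mathbb{T})}\right\}. \]
   Context: $\mathbb{T}$ is the unit circle, identified with $(0,2\pi]$ (arguments taken modulo $2\pi$), with Lebesgue measure $d\theta$ of total mass $2\pi$; $|I|$ is the length of an interval (arc) $I\subset\mathbb{T}$ of positive length, and $\varphi_I=\frac1{|I|}\int_I\varphi\,d\theta$. For $\varphi\in L^1(\mathbb{T})$, $\|\varphi\|_{\mathrm{BMO}(\mathbb{T})}=\sup_I \frac1{|I|}\int_I|\varphi-\varphi_I|\,d\theta\in[0,\infty]$, the supremum being over all intervals $I$ on $\mathbb{T}$. The dyadic intervals are $D_n^k=(2\pi k2^{-n},2\pi(k+1)2^{-n}]$ for $n\ge0$, $0\le k<2^n$, and $\|\varphi\|_{\mathrm{BMO}_{\mathcal D}(\mathbb{T})}=\sup_{n,k}\frac{2^n}{2\pi}\int_{D_n^k}|\varphi-\varphi_{D_n^k}|\,d\theta\in[0,\infty]$. $\varphi(\cdot-2\delta\pi)$ denotes the function $\theta\mapsto\varphi(\theta-2\delta\pi)$ on $\mathbb{T}$. *)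

theory Defs
  imports "HOL-Analysis.Analysis"
begin

text \<open>
  The circle is the set \<open>{0<..2*pi}\<close> with Lebesgue measure. Functions on it are represented by
  functions \<open>real \<Rightarrow> complex\<close> of which only the values on \<open>{0<..2*pi}\<close> matter.
\<close>

definition circle :: "real set" where
  "circle = {0<..2*pi}"

text \<open>The representative in \<open>(0, 2\<pi>]\<close> of an argument modulo \<open>2\<pi>\<close>.\<close>

definition circ_rep :: "real \<Rightarrow> real" where
  "circ_rep t = t - 2*pi * (of_int \<lceil>t / (2*pi)\<rceil> - 1)"

lemma circ_rep_in_circle: "circ_rep t \<in> circle"
proof -
  define y where "y = t / (2*pi)"
  have "of_int \<lceil>y\<rceil> - 1 < y" "y \<le> of_int \<lceil>y\<rceil>"
    by linarith+
  then have "0 < 2*pi * (y - (of_int \<lceil>y\<rceil> - 1))" "2*pi * (y - (of_int \<lceil>y\<rceil> - 1)) \<le> 2*pi * 1"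
    by (simp, intro mult_left_mono, simp_all)
  moreover have "circ_rep t = 2*pi * (y - (of_int \<lceil>y\<rceil> - 1))"
    by (simp add: circ_rep_def y_def field_simps)
  ultimately show ?thesis
    by (simp add: circle_def)
qed

lemma circ_rep_ident: "t \<in> circle \<Longrightarrow> circ_rep t = t"
proof -
  assume "t \<in> circle"
  then have "\<lceil>t / (2*pi)\<rceil> = 1"
    by (auto simp: circle_def ceiling_eq_iff)
  then show ?thesis
    by (simp add: circ_rep_def)
qed

text \<open>
  Arcs of positive length: the images on the circle of arbitrary real intervals (open, closed or
  half-open, possibly passing through the argument \<open>0\<close>; those longer than \<open>2\<pi>\<close> give the circle). The circle itself is an arc.
\<close>

definition arcs :: "real set set" where
  "arcs = {circ_rep ` J | J. is_interval J \<and> measure lebesgue (circ_rep ` J) > 0}"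

definition mean :: "(real \<Rightarrow> complex) \<Rightarrow> real set \<Rightarrow> complex" where
  "mean f I = (LINT t:I|lebesgue. f t) / of_real (measure lebesgue I)"

definition bmo_norm :: "(real \<Rightarrow> complex) \<Rightarrow> ennreal" where
  "bmo_norm f =
     (SUP I\<in>arcs. ennreal (1 / measure lebesgue I * (LINT t:I|lebesgue. cmod (f t - mean f I))))"

definition dyadic :: "nat \<Rightarrow> nat \<Rightarrow> real set" where
  "dyadic n k = {2*pi * real k / 2^n <.. 2*pi * (real k + 1) / 2^n}"

definition bmo_dyadic_norm :: "(real \<Rightarrow> complex) \<Rightarrow> ennreal" where
  "bmo_dyadic_norm f =
     (SUP n. SUP k\<in>{..<2^n}.
        ennreal (2^n / (2*pi) * (LINT t:dyadic n k|lebesgue. cmod (f t - mean f (dyadic n k)))))"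

definition circ_translate :: "real \<Rightarrow> (real \<Rightarrow> complex) \<Rightarrow> real \<Rightarrow> complex" where
  "circ_translate s f = (\<lambda>t. f (circ_rep (t - s)))"

definition dyadic_dist :: "real \<Rightarrow> real" where
  "dyadic_dist \<delta> = Inf {2^n * \<bar>\<delta> - of_int k / 2^n\<bar> | (n::nat) (k::int). True}"

end

theory Submission
  imports Defs
begin

text \<open>
  Mean oscillation is almost monotone: if \<open>I \<subseteq> D\<close>, then the mean oscillation over \<open>I\<close> is at most
  \<open>2 \<bar>D\<bar> / \<bar>I\<bar>\<close> times the one over \<open>D\<close> (\<open>oscillation_subset_le\<close>). So it suffices to put every arc
  \<open>I\<close> into a cell \<open>D\<close>, of the dyadic grid or of its translate by \<open>-2\<pi>\<delta>\<close>, whose length is at most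
  \<open>(2 / d) \<bar>I\<bar>\<close>, where \<open>d = d(\<delta>)\<close>. One dyadic grid cannot do this: a tiny arc around the point
  \<open>\<pi>\<close> lies in no dyadic cell but the whole circle.

  The number \<open>d\<close> says how well the endpoints of the two grids avoid each other. At level \<open>n\<close>, an
  endpoint of the first grid and one of the second differ modulo \<open>2\<pi>\<close> by
  \<open>2\<pi> \<bar>\<delta> - k / 2\<^sup>n\<bar>\<close> for some integer \<open>k\<close>, hence by at least \<open>2\<pi> d / 2\<^sup>n\<close>. An arc shorter than
  this cannot contain endpoints of both grids, and so it lies within a single cell of one of them
  (\<open>short_interval_in_cell\<close>). If \<open>\<bar>I\<bar> < 2\<pi> d\<close>, there is a level \<open>n\<close> with
  \<open>\<pi> d / 2\<^sup>n \<le> \<bar>I\<bar> < 2\<pi> d / 2\<^sup>n\<close>, and the cells of this level have length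
  \<open>2\<pi> / 2\<^sup>n \<le> (2 / d) \<bar>I\<bar>\<close>. If \<open>\<bar>I\<bar> \<ge> 2\<pi> d\<close>, the whole circle serves as \<open>D\<close>.

  The geometry takes place on the real line, where an arc is an interval and a grid is a set of
  translates of one cell. Functions on the circle become \<open>2\<pi>\<close>-periodic by composition with
  \<open>circ_rep\<close>, and on sets within one period this composition preserves measures, integrals and
  thus mean oscillations (\<open>oscillation_circ_rep_image\<close>). A cell of either grid is carried by a
  translation to a cell \<open>dyadic n j\<close>, which turns the function into itself or into its
  translate by \<open>2\<pi>\<delta>\<close> (\<open>oscillation_cell\<close>).
\<close>

section \<open>Mean oscillation\<close>

definition oscillation :: "(real \<Rightarrow> complex) \<Rightarrow> real set \<Rightarrow> real" where
  "oscillation f I = 1 / measure lebesgue I * (LINT t:I|lebesgue. cmod (f t - mean f I))"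

lemma oscillation_nonneg: "0 \<le> oscillation f I"
  by (auto simp: oscillation_def set_lebesgue_integral_def intro!: divide_nonneg_nonneg integral_nonneg)

lemma mean_cong:
  assumes "I \<in> sets lebesgue" "\<And>t. t \<in> I \<Longrightarrow> f t = g t"
  shows "mean f I = mean g I"
  unfolding mean_def using set_lebesgue_integral_cong[of I lebesgue f g] assms by simp

lemma oscillation_cong:
  assumes "I \<in> sets lebesgue" "\<And>t. t \<in> I \<Longrightarrow> f t = g t"
  shows "oscillation f I = oscillation g I"
proof -
  have "mean f I = mean g I"
    using assms by (rule mean_cong)
  then show ?thesis
    unfolding oscillation_def
    using set_lebesgue_integral_cong[of I lebesgue "\<lambda>t. cmod (f t - mean f I)" "\<lambda>t. cmod (g t - mean g I)"] assms
    by simp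
qed

text \<open>
  Comparing with the mean over \<open>P\<close> instead of the one over \<open>J\<close> costs a factor \<open>2\<close>, because the two
  means differ by at most the average over \<open>J\<close> of the distance of \<open>f\<close> to its mean over \<open>P\<close>. After
  that, the integrand no longer depends on \<open>J\<close>, and the integral grows with the set.
\<close>

lemma oscillation_subset_le:
  assumes J: "J \<in> sets lebesgue" and P: "P \<in> lmeasurable" and JP: "J \<subseteq> P"
    and pos: "0 < measure lebesgue J" and f: "set_integrable lebesgue P f"
  shows "oscillation f J \<le> 2 * (measure lebesgue P / measure lebesgue J) * oscillation f P"
proof -
  define c where "c = mean f P"
  let ?j = "measure lebesgue J"
  have Jm: "J \<in> lmeasurable"
    using fmeasurableI2[OF P JP J] .
  have fin: "emeasure lebesgue J \<noteq> \<infinity>" "emeasure lebesgue P \<noteq> \<infinity>"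
    using Jm P by (auto simp: fmeasurable_def)
  have fJ: "set_integrable lebesgue J f"
    by (rule set_integrable_subset[OF f J JP])
  have cJ: "set_integrable lebesgue J (\<lambda>_. a)" and cP: "set_integrable lebesgue P (\<lambda>_. a)" for a :: complex
    using Jm P by (auto simp: set_integrable_def fmeasurable_def)
  have rJ: "set_integrable lebesgue J (\<lambda>_. a)" for a :: real
    using Jm by (auto simp: set_integrable_def fmeasurable_def)
  have dev: "(LINT t:J|lebesgue. f t - c) = of_real ?j * (mean f J - c)"
    using pos set_integral_const[of J lebesgue c] fin J
    by (simp add: set_integral_diff fJ cJ mean_def scaleR_conv_of_real field_simps)
  have "?j * cmod (mean f J - c) = cmod (LINT t:J|lebesgue. f t - c)"
    by (simp add: dev norm_mult)
  also have "\<dots> \<le> (LINT t:J|lebesgue. cmod (f t - c))"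
    by (intro set_integral_norm_bound set_integral_diff fJ cJ)
  finally have meandev: "?j * cmod (mean f J - c) \<le> (LINT t:J|lebesgue. cmod (f t - c))" .
  have iJ: "set_integrable lebesgue J (\<lambda>t. cmod (f t - a))" for a
    by (intro set_integrable_norm set_integral_diff fJ cJ)
  have "(LINT t:J|lebesgue. cmod (f t - mean f J)) \<le> (LINT t:J|lebesgue. cmod (f t - c) + cmod (mean f J - c))"
  proof (intro set_integral_mono set_integral_add iJ rJ)
    show "cmod (f t - mean f J) \<le> cmod (f t - c) + cmod (mean f J - c)" for t
      using norm_triangle_ineq4[of "f t - c" "mean f J - c"] by simp
  qed
  also have "\<dots> = (LINT t:J|lebesgue. cmod (f t - c)) + ?j * cmod (mean f J - c)"
    using set_integral_const[of J lebesgue "cmod (mean f J - c)"] fin J by (simp add: set_integral_add iJ rJ)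
  also have "\<dots> \<le> 2 * (LINT t:J|lebesgue. cmod (f t - c))"
    using meandev by simp
  also have "(LINT t:J|lebesgue. cmod (f t - c)) \<le> (LINT t:P|lebesgue. cmod (f t - c))"
  proof -
    have "set_integrable lebesgue P (\<lambda>t. cmod (f t - c))"
      by (intro set_integrable_norm set_integral_diff f cP)
    then show ?thesis
      using iJ[of c] JP unfolding set_integrable_def set_lebesgue_integral_def
      by (intro integral_mono) (auto split: split_indicator)
  qed
  also have "(LINT t:P|lebesgue. cmod (f t - c)) = measure lebesgue P * oscillation f P"
    using pos measure_mono_fmeasurable[OF JP J P] by (simp add: oscillation_def c_def)
  finally show ?thesis
    unfolding oscillation_def[of f J] using pos by (simp add: field_simps)
qed

section \<open>Translations and the projection to the circle\<close>

lemma set_integral_translate: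
  fixes f :: "real \<Rightarrow> 'a::euclidean_space"
  shows "(LINT t:(+) a ` S|lebesgue. f t) = (LINT t:S|lebesgue. f (a + t))"
    and "set_integrable lebesgue ((+) a ` S) f \<longleftrightarrow> set_integrable lebesgue S (\<lambda>t. f (a + t))"
proof -
  have eq: "indicator ((+) a ` S) (a + x) = (indicator S x :: real)" for x
    by (auto simp: indicator_def)
  show "(LINT t:(+) a ` S|lebesgue. f t) = (LINT t:S|lebesgue. f (a + t))"
    unfolding set_lebesgue_integral_def
    using lebesgue_integral_real_affine[of 1 "\<lambda>t. indicator ((+) a ` S) t *\<^sub>R f t" a] by (simp add: eq)
  show "set_integrable lebesgue ((+) a ` S) f \<longleftrightarrow> set_integrable lebesgue S (\<lambda>t. f (a + t))"
    unfolding set_integrable_def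
    using lebesgue_integrable_real_affine_iff[of 1 "\<lambda>t. indicator ((+) a ` S) t *\<^sub>R f t" a] by (simp add: eq)
qed

lemma oscillation_translate: "oscillation f ((+) a ` S) = oscillation (\<lambda>t. f (a + t)) S"
  by (simp add: oscillation_def mean_def set_integral_translate measure_translation)

lemma circ_rep_periodic: "circ_rep (t + 2*pi * of_int m) = circ_rep t"
proof -
  have "(t + 2*pi * of_int m) / (2*pi) = t / (2*pi) + of_int m"
    by (simp add: field_simps)
  then have "\<lceil>(t + 2*pi * of_int m) / (2*pi)\<rceil> = \<lceil>t / (2*pi)\<rceil> + m"
    by simp
  then show ?thesis
    unfolding circ_rep_def by (simp add: algebra_simps)
qed

lemma circ_rep_eqE:
  assumes "circ_rep s = circ_rep t"
  obtains m :: int where "s = t + 2*pi * of_int m"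
proof
  show "s = t + 2*pi * of_int (\<lceil>s / (2*pi)\<rceil> - \<lceil>t / (2*pi)\<rceil>)"
    using assms by (simp only: circ_rep_def of_int_diff right_diff_distrib)
qed

lemma circ_rep_inj_on: "inj_on circ_rep {c<..c + 2*pi}"
proof (rule inj_onI)
  fix s t assume st: "s \<in> {c<..c + 2*pi}" "t \<in> {c<..c + 2*pi}" and "circ_rep s = circ_rep t"
  then obtain m :: int where m: "s = t + 2*pi * of_int m"
    using circ_rep_eqE by blast
  have "2*pi * of_int m < 2*pi * 1" "2*pi * (-1) < 2*pi * of_int m"
    using st m unfolding greaterThanAtMost_iff by linarith+
  then have "of_int m < (1::real)" "(-1::real) < of_int m"
    using mult_less_cancel_left_pos[of "2*pi" "of_int m" 1] mult_less_cancel_left_pos[of "2*pi" "-1" "of_int m"]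
    by simp_all
  then show "s = t"
    using m by simp
qed

text \<open>
  The real line is cut into the intervals on which the projection \<open>circ_rep\<close> to the circle is
  a single translation.
\<close>

definition sheet :: "int \<Rightarrow> real set" where
  "sheet m = {2*pi * of_int m<..2*pi * of_int m + 2*pi}"

lemma sheet_measurable [measurable]: "sheet m \<in> sets lebesgue"
  by (simp add: sheet_def)

lemma circ_rep_on_sheet: "t \<in> sheet m \<Longrightarrow> circ_rep t = - (2*pi * of_int m) + t"
  using circ_rep_ident[of "t - 2*pi * of_int m"] circ_rep_periodic[of t "-m"]
  by (simp add: circle_def sheet_def)

lemma circ_rep_image_sheet: "S \<subseteq> sheet m \<Longrightarrow> circ_rep ` S = (+) (- (2*pi * of_int m)) ` S"
  by (intro image_cong refl circ_rep_on_sheet) blast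

lemma sheet_image: "circle = (+) (- (2*pi * of_int m)) ` sheet m"
  unfolding circle_def sheet_def image_add_greaterThanAtMost by simp

lemma set_integrable_comp_circ_rep_sheet:
  fixes g :: "real \<Rightarrow> 'a::euclidean_space"
  assumes "set_integrable lebesgue circle g"
  shows "set_integrable lebesgue (sheet m) (g \<circ> circ_rep)"
proof -
  have "set_integrable lebesgue (sheet m) (\<lambda>t. g (- (2*pi * of_int m) + t))"
    using assms set_integral_translate(2)[where S = "sheet m" and a = "- (2*pi * of_int m)" and f = g]
    unfolding sheet_image[of m, symmetric] by blast
  then show ?thesis
    by (subst set_integrable_cong[where A' = "sheet m" and f' = "\<lambda>t. g (- (2*pi * of_int m) + t)"])
      (auto simp: circ_rep_on_sheet)
qed

lemma period_covered_by_sheets: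
  obtains m where "{c<..c + 2*pi} \<subseteq> sheet m \<union> sheet (m + 1)"
proof
  let ?m = "\<lfloor>c / (2*pi)\<rfloor>"
  have "2*pi * ?m \<le> c" "c < 2*pi * (?m + 1)"
    using floor_divide_lower[of "2*pi" c] floor_divide_upper[of "2*pi" c] by (simp_all add: mult.commute)
  then show "{c<..c + 2*pi} \<subseteq> sheet ?m \<union> sheet (?m + 1)"
    by (auto simp: sheet_def algebra_simps)
qed

text \<open>
  A set within one period meets at most two sheets. On each of its two parts the projection is a
  translation, and the images of the parts are disjoint since the projection is injective on a
  period.
\<close>

lemma
  fixes g :: "real \<Rightarrow> 'a::euclidean_space"
  assumes S: "S \<in> sets lebesgue" "S \<subseteq> {c<..c + 2*pi}" and g: "set_integrable lebesgue circle g"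
  shows set_integrable_comp_circ_rep: "set_integrable lebesgue S (g \<circ> circ_rep)"
    and set_integral_circ_rep_image: "(LINT t:circ_rep ` S|lebesgue. g t) = (LINT t:S|lebesgue. g (circ_rep t))"
proof -
  obtain m where m: "{c<..c + 2*pi} \<subseteq> sheet m \<union> sheet (m + 1)"
    by (rule period_covered_by_sheets)
  define S1 S2 where "S1 = S \<inter> sheet m" and "S2 = S \<inter> sheet (m + 1)"
  have split: "S = S1 \<union> S2" "S1 \<inter> S2 = {}"
    using S(2) m by (auto simp: S1_def S2_def sheet_def algebra_simps)
  have meas: "S1 \<in> sets lebesgue" "S2 \<in> sets lebesgue"
    using S(1) by (auto simp: S1_def S2_def)
  have single: "set_integrable lebesgue T (g \<circ> circ_rep) \<and> set_integrable lebesgue (circ_rep ` T) g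
      \<and> (LINT t:circ_rep ` T|lebesgue. g t) = (LINT t:T|lebesgue. g (circ_rep t))"
    if T: "T \<in> sets lebesgue" "T \<subseteq> sheet k" for T k
  proof -
    have eq: "g (circ_rep t) = g (- (2*pi * of_int k) + t)" if "t \<in> T" for t
      using that T circ_rep_on_sheet by force
    have 1: "set_integrable lebesgue T (g \<circ> circ_rep)"
      by (rule set_integrable_subset[OF set_integrable_comp_circ_rep_sheet[OF g] T])
    then have "set_integrable lebesgue T (\<lambda>t. g (- (2*pi * of_int k) + t))"
      by (subst (asm) set_integrable_cong[where A' = T and f' = "\<lambda>t. g (- (2*pi * of_int k) + t)"])
        (auto simp: eq)
    then have 2: "set_integrable lebesgue (circ_rep ` T) g"
      unfolding circ_rep_image_sheet[OF T(2)] set_integral_translate .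
    have "(LINT t:circ_rep ` T|lebesgue. g t) = (LINT t:T|lebesgue. g (circ_rep t))"
      unfolding circ_rep_image_sheet[OF T(2)] set_integral_translate
      using T(1) eq by (intro set_lebesgue_integral_cong) auto
    with 1 2 show ?thesis by blast
  qed
  have s1: "set_integrable lebesgue S1 (g \<circ> circ_rep)" "set_integrable lebesgue (circ_rep ` S1) g"
      "(LINT t:circ_rep ` S1|lebesgue. g t) = (LINT t:S1|lebesgue. g (circ_rep t))"
    and s2: "set_integrable lebesgue S2 (g \<circ> circ_rep)" "set_integrable lebesgue (circ_rep ` S2) g"
      "(LINT t:circ_rep ` S2|lebesgue. g t) = (LINT t:S2|lebesgue. g (circ_rep t))"
    using single[OF meas(1), of m] single[OF meas(2), of "m + 1"] by (auto simp: S1_def S2_def)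
  show "set_integrable lebesgue S (g \<circ> circ_rep)"
    unfolding split(1) by (intro set_integrable_Un s1 s2 meas)
  have "circ_rep ` S1 \<inter> circ_rep ` S2 = {}"
    using inj_on_image_Int[OF circ_rep_inj_on[of c], of S1 S2] S(2) split by auto
  then have "(LINT t:circ_rep ` S|lebesgue. g t)
      = (LINT t:circ_rep ` S1|lebesgue. g t) + (LINT t:circ_rep ` S2|lebesgue. g t)"
    unfolding split(1) image_Un by (intro set_integral_Un s1 s2)
  also have "\<dots> = (LINT t:S|lebesgue. g (circ_rep t))"
    unfolding s1 s2 using set_integral_Un[OF split(2) s1(1) s2(1)] split(1) by (simp add: o_def)
  finally show "(LINT t:circ_rep ` S|lebesgue. g t) = (LINT t:S|lebesgue. g (circ_rep t))" .
qed

lemma lmeasurable_subset_Ioc: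
  fixes S :: "real set"
  assumes "S \<in> sets lebesgue" "S \<subseteq> {a<..b}"
  shows "S \<in> lmeasurable"
proof (rule bounded_set_imp_lmeasurable[OF _ assms(1)])
  show "bounded S"
    using assms(2) by (intro bounded_subset[OF compact_imp_bounded[OF compact_Icc[of a b]]]) auto
qed

lemma circle_lmeasurable: "circle \<in> lmeasurable"
  unfolding circle_def by (rule lmeasurable_subset_Ioc) auto

lemma sets_circ_rep_image:
  assumes S: "S \<in> sets lebesgue" "S \<subseteq> {c<..c + 2*pi}"
  shows "circ_rep ` S \<in> sets lebesgue"
proof -
  obtain m where m: "{c<..c + 2*pi} \<subseteq> sheet m \<union> sheet (m + 1)"
    by (rule period_covered_by_sheets)
  have "circ_rep ` S = circ_rep ` (S \<inter> sheet m) \<union> circ_rep ` (S \<inter> sheet (m + 1))"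
    using S(2) m by auto
  also have "\<dots> \<in> sets lebesgue"
    unfolding circ_rep_image_sheet[OF Int_lower2]
    by (intro sets.Un lebesgue_sets_translation sets.Int S(1) sheet_measurable)
  finally show ?thesis .
qed

lemma measure_circ_rep_image:
  assumes S: "S \<in> sets lebesgue" "S \<subseteq> {c<..c + 2*pi}"
  shows "measure lebesgue (circ_rep ` S) = measure lebesgue S"
proof -
  have fin: "emeasure lebesgue S \<noteq> \<infinity>"
    using lmeasurable_subset_Ioc[OF S] by (auto simp: fmeasurable_def)
  have "circ_rep ` S \<subseteq> {0<..2*pi}"
    using circ_rep_in_circle by (auto simp: circle_def)
  then have "circ_rep ` S \<in> lmeasurable"
    by (rule lmeasurable_subset_Ioc[OF sets_circ_rep_image[OF S]])
  then have fin': "emeasure lebesgue (circ_rep ` S) \<noteq> \<infinity>"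
    by (auto simp: fmeasurable_def)
  have "set_integrable lebesgue circle (\<lambda>_. 1::real)"
    using circle_lmeasurable by (auto simp: set_integrable_def fmeasurable_def)
  from set_integral_circ_rep_image[OF S this] show ?thesis
    using set_integral_const[OF S(1) fin, of "1::real"]
      set_integral_const[OF sets_circ_rep_image[OF S] fin', of "1::real"] by simp
qed

lemma oscillation_circ_rep_image:
  assumes S: "S \<in> sets lebesgue" "S \<subseteq> {c<..c + 2*pi}" and f: "set_integrable lebesgue circle f"
  shows "oscillation f (circ_rep ` S) = oscillation (f \<circ> circ_rep) S"
proof -
  have mean: "mean f (circ_rep ` S) = mean (f \<circ> circ_rep) S"
    unfolding mean_def measure_circ_rep_image[OF S] set_integral_circ_rep_image[OF S f] by (simp add: o_def)
  have "set_integrable lebesgue circle (\<lambda>_. a)" for a :: complex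
    using circle_lmeasurable by (auto simp: set_integrable_def fmeasurable_def)
  then have "set_integrable lebesgue circle (\<lambda>t. cmod (f t - a))" for a
    by (intro set_integrable_norm set_integral_diff f)
  from set_integral_circ_rep_image[OF S this] show ?thesis
    unfolding oscillation_def measure_circ_rep_image[OF S] mean by (simp add: o_def)
qed

text \<open>
  The size of an arc is only given as the measure of its projection, from which a bound for the
  interval upstairs has to be recovered. An interval longer than \<open>2\<pi>\<close> would cover the circle;
  otherwise the projection is injective on \<open>{x<..y}\<close> and preserves its length.
\<close>

lemma diameter_le_measure_circ_rep_image:
  assumes J: "is_interval J" "x \<in> J" "y \<in> J" and I: "circ_rep ` J \<in> sets lebesgue"
    and small: "measure lebesgue (circ_rep ` J) < 2*pi"
  shows "y - x \<le> measure lebesgue (circ_rep ` J)"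
proof (cases "x \<le> y")
  case True
  \<comment> \<open>Truncating at one period makes the projection injective; if \<open>z < y\<close>, the image has measure \<open>2\<pi>\<close>.\<close>
  define z where "z = min y (x + 2*pi)"
  have z: "{x<..z} \<subseteq> {x<..x + 2*pi}" "x \<le> z"
    using True by (auto simp: z_def)
  have "{x<..z} \<subseteq> J"
    using J by (auto simp: z_def intro: mem_is_interval_1_I[of J x y])
  moreover have "circ_rep ` J \<in> lmeasurable"
    using I circ_rep_in_circle by (intro lmeasurable_subset_Ioc[of _ 0 "2*pi"]) (auto simp: circle_def)
  ultimately have "measure lebesgue (circ_rep ` {x<..z}) \<le> measure lebesgue (circ_rep ` J)"
    using z(1) by (intro measure_mono_fmeasurable sets_circ_rep_image[of _ x]) auto
  then have "z - x \<le> measure lebesgue (circ_rep ` J)"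
    using measure_circ_rep_image[OF _ z(1)] z(2) by simp
  then show ?thesis
    using small by (auto simp: z_def min_def split: if_splits)
next
  case False
  then show ?thesis
    using measure_nonneg[of lebesgue "circ_rep ` J"] by linarith
qed

section \<open>Two dyadic grids\<close>

lemma dyadic_dist_le: "dyadic_dist \<delta> \<le> 2^n * \<bar>\<delta> - of_int k / 2^n\<bar>"
  unfolding dyadic_dist_def by (rule cInf_lower) (auto intro!: bdd_belowI[of _ 0])

text \<open>
  The cell of a point \<open>x\<close> is read off from \<open>\<lceil>(x + s) / h\<rceil>\<close>. If this number takes two values on \<open>J\<close>,
  then an endpoint of the grid separates two points of \<open>J\<close>, and so it belongs to \<open>J\<close>.
\<close>

lemma interval_in_cell_or_meets_grid:
  fixes J :: "real set"
  assumes J: "is_interval J" and h: "0 < h"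
  shows "(\<exists>k::int. \<forall>x\<in>J. h * of_int k < x + s \<and> x + s \<le> h * (of_int k + 1)) \<or> (\<exists>k::int. h * of_int k - s \<in> J)"
proof (cases "\<exists>x\<in>J. \<exists>y\<in>J. \<lceil>(x + s) / h\<rceil> < \<lceil>(y + s) / h\<rceil>")
  case True
  then obtain x y where xy: "x \<in> J" "y \<in> J" "\<lceil>(x + s) / h\<rceil> < \<lceil>(y + s) / h\<rceil>"
    by blast
  let ?k = "\<lceil>(x + s) / h\<rceil>"
  have "(x + s) / h \<le> of_int ?k" "of_int ?k < (y + s) / h"
    using xy(3) by (auto simp: less_ceiling_iff)
  then have "x + s \<le> h * of_int ?k" "h * of_int ?k < y + s"
    using h by (simp_all only: pos_divide_le_eq pos_less_divide_eq mult.commute)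
  then have "h * of_int ?k - s \<in> J"
    by (intro mem_is_interval_1_I[OF J xy(1,2)]) auto
  then show ?thesis by blast
next
  case False
  show ?thesis
  proof (cases "J = {}")
    case False
    then obtain x0 where x0: "x0 \<in> J" by blast
    have "h * of_int (\<lceil>(x0 + s) / h\<rceil> - 1) < x + s \<and> x + s \<le> h * (of_int (\<lceil>(x0 + s) / h\<rceil> - 1) + 1)"
      if "x \<in> J" for x
    proof -
      have "\<lceil>(x + s) / h\<rceil> = \<lceil>(x0 + s) / h\<rceil>"
        using \<open>\<not> (\<exists>x\<in>J. _ x)\<close> that x0 by (meson linorder_neqE)
      then have "of_int (\<lceil>(x0 + s) / h\<rceil> - 1) < (x + s) / h" "(x + s) / h \<le> of_int (\<lceil>(x0 + s) / h\<rceil> - 1) + 1"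
        by linarith+
      then show ?thesis
        using h by (simp only: pos_divide_le_eq pos_less_divide_eq mult.commute)
    qed
    then show ?thesis by blast
  qed auto
qed

text \<open>
  If \<open>J\<close> lay in no cell of either grid, it would contain an endpoint of each, but two such
  endpoints are at least \<open>2\<pi> d(\<delta>) / 2\<^sup>n\<close> apart. The offset \<open>s\<close> in \<open>x + s\<close> moves the grid by \<open>-s\<close>,
  as is needed for functions that are translated by \<open>s\<close>.
\<close>

lemma short_interval_in_cell:
  fixes J :: "real set"
  assumes J: "is_interval J" and short: "\<And>x y. x \<in> J \<Longrightarrow> y \<in> J \<Longrightarrow> y - x \<le> r"
    and r: "r < 2*pi * (dyadic_dist \<delta> / 2^n)"
  obtains s and k :: int where "s \<in> {0, 2 * \<delta> * pi}"
    "\<And>x. x \<in> J \<Longrightarrow> 2*pi / 2^n * of_int k < x + s \<and> x + s \<le> 2*pi / 2^n * (of_int k + 1)"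
proof -
  have "\<exists>s\<in>{0, 2 * \<delta> * pi}. \<exists>k::int. \<forall>x\<in>J. 2*pi / 2^n * of_int k < x + s \<and> x + s \<le> 2*pi / 2^n * (of_int k + 1)"
  proof (rule ccontr)
    assume no: "\<not> ?thesis"
    have "\<exists>k::int. 2*pi / 2^n * of_int k - s \<in> J" if "s \<in> {0, 2 * \<delta> * pi}" for s
    proof -
      have "0 < 2*pi / 2^n"
        by simp
      from interval_in_cell_or_meets_grid[OF J this, of s] show ?thesis
        using no that by blast
    qed
    then obtain p q :: int where pq: "2*pi / 2^n * of_int p - 0 \<in> J" "2*pi / 2^n * of_int q - 2 * \<delta> * pi \<in> J"
      by (metis insertI1 insertI2)
    have "\<bar>(2*pi / 2^n * of_int q - 2 * \<delta> * pi) - (2*pi / 2^n * of_int p - 0)\<bar> \<le> r"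
      using short[OF pq] short[OF pq(2,1)] by (simp add: abs_le_iff)
    moreover have "(2*pi / 2^n * of_int q - 2 * \<delta> * pi) - (2*pi / 2^n * of_int p - 0)
        = - (2*pi * (\<delta> - of_int (q - p) / 2^n))"
      by (simp add: field_simps)
    ultimately have "2*pi * \<bar>\<delta> - of_int (q - p) / 2^n\<bar> \<le> r"
      by (simp add: abs_mult)
    moreover have "2*pi * (dyadic_dist \<delta> / 2^n) \<le> 2*pi * \<bar>\<delta> - of_int (q - p) / 2^n\<bar>"
      using dyadic_dist_le[of \<delta> n "q - p"] by (intro mult_left_mono) (simp_all add: field_simps)
    ultimately show False
      using r by linarith
  qed
  then show thesis using that by blast
qed

lemma comparable_dyadic_scale:
  fixes a x :: real
  assumes "0 < x" "x < a"
  obtains n where "x < a / 2^n" "a / 2^n \<le> 2 * x"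
proof -
  \<comment> \<open>For \<open>n > 0\<close>, minimality means that \<open>P (n - 1)\<close> fails, which is the strict bound \<open>x < a / 2\<^sup>n\<close>.\<close>
  define P where "P = (\<lambda>n::nat. a / 2^Suc n \<le> x)"
  obtain N where "a / x < 2^N"
    using real_arch_pow[of 2 "a / x"] by auto
  then have "P N"
    using assms by (simp add: P_def field_simps)
  define n where "n = (LEAST n. P n)"
  have "P n"
    unfolding n_def by (rule LeastI, fact)
  moreover have "x < a / 2^n"
  proof (cases n)
    case (Suc m)
    then have "\<not> P m"
      using not_less_Least[of m P] n_def by simp
    then show ?thesis
      by (simp add: P_def Suc)
  qed (use assms in simp)
  ultimately show thesis
    using that[of n] by (simp add: P_def field_simps)
qed

section \<open>Comparison of the norms\<close>

lemma dyadic_subset_circle: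
  assumes "k < 2^n"
  shows "dyadic n k \<subseteq> circle"
proof -
  have "real k + 1 \<le> 2^n"
    using assms by (metis Suc_leI of_nat_Suc of_nat_le_iff of_nat_numeral of_nat_power add.commute)
  then have "2*pi * (real k + 1) / 2^n \<le> 2*pi * 2^n / 2^n"
    by (intro divide_right_mono mult_left_mono) auto
  then have "2*pi * (real k + 1) / 2^n \<le> 2*pi"
    by simp
  moreover have "0 \<le> 2*pi * real k / 2^n"
    by simp
  ultimately show ?thesis
    unfolding dyadic_def circle_def by (auto simp only: greaterThanAtMost_iff)
qed

lemma measure_dyadic: "measure lebesgue (dyadic n k) = 2*pi / 2^n"
  by (simp add: dyadic_def field_simps)

lemma oscillation_dyadic_le:
  assumes "k < 2^n"
  shows "ennreal (oscillation f (dyadic n k)) \<le> bmo_dyadic_norm f"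
proof -
  have "oscillation f (dyadic n k) = 2^n / (2*pi) * (LINT t:dyadic n k|lebesgue. cmod (f t - mean f (dyadic n k)))"
    by (simp add: oscillation_def measure_dyadic)
  then show ?thesis
    unfolding bmo_dyadic_norm_def using assms
    by (intro SUP_upper2[of n UNIV] SUP_upper2[of k "{..<2^n}"]) auto
qed

text \<open>
  Translation by \<open>0\<close> replaces a function by its periodic continuation from the circle. This lets
  both grids be treated alike, with an offset \<open>s\<close> that may be \<open>0\<close>.
\<close>

lemma bmo_dyadic_norm_translate_0: "bmo_dyadic_norm (circ_translate 0 f) = bmo_dyadic_norm f"
proof -
  have "2^n / (2*pi) * (LINT t:dyadic n k|lebesgue. cmod (circ_translate 0 f t - mean (circ_translate 0 f) (dyadic n k)))
     = 2^n / (2*pi) * (LINT t:dyadic n k|lebesgue. cmod (f t - mean f (dyadic n k)))" if "k < 2^n" for n k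
  proof -
    have "circ_translate 0 f t = f t" if "t \<in> dyadic n k" for t
      using that dyadic_subset_circle[OF \<open>k < 2^n\<close>] by (auto simp: circ_translate_def circ_rep_ident)
    moreover have "dyadic n k \<in> sets lebesgue"
      by (simp add: dyadic_def)
    ultimately have "oscillation (circ_translate 0 f) (dyadic n k) = oscillation f (dyadic n k)"
      by (intro oscillation_cong)
    then show ?thesis
      by (simp add: oscillation_def measure_dyadic)
  qed
  then show ?thesis
    unfolding bmo_dyadic_norm_def by (auto intro!: SUP_cong)
qed

text \<open>
  Modulo the period, the cell \<open>P\<close> with index \<open>k\<close> is the cell \<open>dyadic n (k mod 2\<^sup>n)\<close> moved by \<open>-s\<close>; moving it
  back turns the periodic function \<open>f \<circ> circ_rep\<close> into its translate by \<open>s\<close>.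
\<close>

lemma oscillation_cell:
  fixes k :: int
  assumes P: "P = {x. 2*pi / 2^n * of_int k < x + s \<and> x + s \<le> 2*pi / 2^n * (of_int k + 1)}"
  obtains j where "j < 2^n" "oscillation (f \<circ> circ_rep) P = oscillation (circ_translate s f) (dyadic n j)"
proof -
  define j m where "j = nat (k mod 2^n)" and "m = k div 2^n"
  have "real_of_int k = real_of_int (m * 2^n + k mod 2^n)"
    unfolding m_def by (simp only: div_mult_mod_eq)
  then have k: "real_of_int k = real j + of_int m * 2^n"
    by (simp add: j_def)
  have "j < 2^n"
    by (simp add: j_def nat_less_iff)
  define a where "a = 2*pi * of_int m - s"
  have "P = {a + 2*pi * real j / 2^n <.. a + 2*pi * (real j + 1) / 2^n}"
    unfolding P a_def k by (auto simp: field_simps)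
  then have "P = (+) a ` dyadic n j"
    by (simp add: dyadic_def)
  moreover have "f (circ_rep (a + t)) = circ_translate s f t" for t
    using circ_rep_periodic[of "t - s" m] by (simp add: a_def circ_translate_def algebra_simps)
  ultimately have "oscillation (f \<circ> circ_rep) P = oscillation (circ_translate s f) (dyadic n j)"
    by (simp add: oscillation_translate)
  then show thesis
    using that \<open>j < 2^n\<close> by blast
qed

text \<open>
  The constant \<open>4 / d(\<delta>)\<close> is the product of the factor \<open>2\<close> from \<open>oscillation_subset_le\<close> and of the
  bound \<open>2 / d(\<delta>)\<close> for the ratio of lengths, in which the \<open>2\<close> comes from rounding the length
  of the arc to a dyadic scale.
\<close>

lemma arc_oscillation_le:
  assumes \<delta>: "0 < \<delta>" "\<delta> < 1" and d: "0 < dyadic_dist \<delta>"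
    and f: "set_integrable lebesgue circle f" and I: "I \<in> arcs"
  obtains s n k where "s \<in> {0, 2 * \<delta> * pi}" "k < 2^n"
    "oscillation f I \<le> 4 / dyadic_dist \<delta> * oscillation (circ_translate s f) (dyadic n k)"
proof -
  let ?d = "dyadic_dist \<delta>"
  obtain J where J: "is_interval J" "I = circ_rep ` J" and pos: "0 < measure lebesgue I"
    using I by (auto simp: arcs_def)
  \<comment> \<open>Sets that are not measurable have \<open>measure\<close> zero by convention.\<close>
  have Im: "I \<in> sets lebesgue"
    using pos measure_notin_sets by force
  have sub: "I \<subseteq> circle"
    using J circ_rep_in_circle by auto
  show thesis
  proof (cases "2*pi * ?d \<le> measure lebesgue I")
    case True
    have c: "dyadic 0 0 = circle"
      by (simp add: dyadic_def circle_def)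
    have "oscillation (circ_translate 0 f) circle = oscillation f circle"
      by (intro oscillation_cong) (auto simp: circle_lmeasurable fmeasurableD circ_translate_def circ_rep_ident)
    moreover have "oscillation f I \<le> 2 * (2*pi / measure lebesgue I) * oscillation f circle"
      using oscillation_subset_le[OF Im circle_lmeasurable sub pos f] by (simp add: circle_def)
    moreover have "2 * (2*pi / measure lebesgue I) \<le> 4 / ?d"
      using True d pos by (simp add: field_simps)
    ultimately have "oscillation f I \<le> 4 / ?d * oscillation (circ_translate 0 f) (dyadic 0 0)"
      unfolding c using mult_right_mono[OF _ oscillation_nonneg[of f circle]] by (metis order_trans)
    then show thesis
      by (intro that[of 0 0 0]) auto
  next
    case False
    then obtain n where n: "measure lebesgue I < 2*pi * ?d / 2^n" "2*pi * ?d / 2^n \<le> 2 * measure lebesgue I"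
      using comparable_dyadic_scale[of "measure lebesgue I" "2*pi * ?d"] pos by auto
    \<comment> \<open>Hence the arc is shorter than the circle, so that it stems from an interval within one period.\<close>
    have "?d < 1"
      using dyadic_dist_le[of \<delta> 0 0] \<delta> by simp
    then have small: "measure lebesgue I < 2*pi"
      using False by (smt (verit) mult_left_le pi_gt_zero)
    have diam: "y - x \<le> measure lebesgue I" if "x \<in> J" "y \<in> J" for x y
      using diameter_le_measure_circ_rep_image[OF J(1) that] Im small J(2) by simp
    obtain s and k :: int where s: "s \<in> {0, 2 * \<delta> * pi}"
      and cell: "\<And>x. x \<in> J \<Longrightarrow> 2*pi / 2^n * of_int k < x + s \<and> x + s \<le> 2*pi / 2^n * (of_int k + 1)"
      using short_interval_in_cell[OF J(1) diam, of \<delta> n] n(1) by auto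
    define P where "P = {x. 2*pi / 2^n * of_int k < x + s \<and> x + s \<le> 2*pi / 2^n * (of_int k + 1)}"
    define c where "c = 2*pi / 2^n * of_int k - s"
    have Pc: "P = {c<..c + 2*pi / 2^n}"
      by (auto simp: P_def c_def algebra_simps add_divide_distrib)
    have "2*pi / 2^n \<le> 2*pi"
      by (simp add: field_simps)
    then have Psub: "P \<subseteq> {c<..c + 2*pi}"
      unfolding Pc by auto
    have JP: "J \<subseteq> P"
      using cell by (auto simp: P_def)
    have Jm: "J \<in> sets lebesgue"
      using real_interval_borel_measurable[OF J(1)] by auto
    have Jmeas: "measure lebesgue J = measure lebesgue I"
      unfolding J(2) using measure_circ_rep_image[OF Jm] JP Psub by (metis order_trans)
    have Pm: "P \<in> lmeasurable"
      unfolding Pc by (rule lmeasurable_subset_Ioc) auto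
    obtain j where j: "j < 2^n" "oscillation (f \<circ> circ_rep) P = oscillation (circ_translate s f) (dyadic n j)"
      using oscillation_cell[OF P_def] .
    have "oscillation f I = oscillation (f \<circ> circ_rep) J"
      unfolding J(2) using oscillation_circ_rep_image[OF Jm _ f] JP Psub by (metis order_trans)
    also have "\<dots> \<le> 2 * (measure lebesgue P / measure lebesgue J) * oscillation (f \<circ> circ_rep) P"
      using pos Jmeas
      by (intro oscillation_subset_le Jm Pm JP set_integrable_comp_circ_rep[OF fmeasurableD[OF Pm] Psub f]) auto
    also have "\<dots> \<le> 4 / ?d * oscillation (f \<circ> circ_rep) P"
      using n(2) d pos by (intro mult_right_mono oscillation_nonneg) (simp add: Jmeas Pc field_simps)
    finally show thesis
      using that[OF s j(1)] j(2) by simp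
  qed
qed

theorem theorem2p2:
  fixes \<delta> :: real and \<phi> :: "real \<Rightarrow> complex"
  assumes "0 < \<delta>" and "\<delta> < 1"
    and "dyadic_dist \<delta> > 0"
    and "set_integrable lebesgue circle \<phi>"
  shows "bmo_norm \<phi> \<le> ennreal (4 / dyadic_dist \<delta>) *
           max (bmo_dyadic_norm \<phi>) (bmo_dyadic_norm (circ_translate (2 * \<delta> * pi) \<phi>))"
  unfolding bmo_norm_def oscillation_def[symmetric]
proof (rule SUP_least)
  fix I assume "I \<in> arcs"
  then obtain s n k where s: "s \<in> {0, 2 * \<delta> * pi}" and k: "k < (2::nat)^n"
    and le: "oscillation \<phi> I \<le> 4 / dyadic_dist \<delta> * oscillation (circ_translate s \<phi>) (dyadic n k)"
    using arc_oscillation_le[OF assms] by metis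
  have "ennreal (oscillation \<phi> I)
      \<le> ennreal (4 / dyadic_dist \<delta>) * ennreal (oscillation (circ_translate s \<phi>) (dyadic n k))"
    using le assms(3) by (simp add: ennreal_mult[symmetric] oscillation_nonneg ennreal_leI)
  also have "ennreal (oscillation (circ_translate s \<phi>) (dyadic n k)) \<le> bmo_dyadic_norm (circ_translate s \<phi>)"
    by (rule oscillation_dyadic_le[OF k])
  also have "\<dots> \<le> max (bmo_dyadic_norm \<phi>) (bmo_dyadic_norm (circ_translate (2 * \<delta> * pi) \<phi>))"
    using s by (auto simp: bmo_dyadic_norm_translate_0)
  finally show "ennreal (oscillation \<phi> I) \<le> ennreal (4 / dyadic_dist \<delta>) *
      max (bmo_dyadic_norm \<phi>) (bmo_dyadic_norm (circ_translate (2 * \<delta> * pi) \<phi>))"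
    by (simp add: mult_left_mono)
qed

end
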